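(* Let $G$ be a countable discrete group acting by homeomorphisms on a compact Hausdorff topological space $X$. The action of $G$ on $X$ is amenable if and only if there exists an invariant mean for the action, i.e. an element $\mu\in W_0(G,X)^{**}$ with $\mu(\pi)=1$ and $\mu(g\varphi)=\mu(\varphi)$ for all $g\in G$ and all $\varphi\in W_0(G,X)^*$.
   Context: $X$ is nonempty. $C(X)$ is the Banach algebra of real-valued continuous functions on $X$ with the supremum norm; $1_X$ is the constant function $1$. $G$ acts on $C(X)$ by $(g\cdot t)(x)=t(g^{-1}x)$. For a function $f:G\to C(X)$ write $f_g\in C(X)$ for its value at $g\in G$, and set $\|f\|_{\infty,1}=\sup_{x\in X}\sum_{g\in G}|f_g(x)|$. $V$ denotes the Banach space of all $f:G\to C(X)$ with $\|f\|_{\infty,1}<\infty$ (so $\|\cdot\|_V=\|\cdot\|_{\infty,1}$). $G$ acts isometrically on $V$ by $(gf)_h(x)=f_{g^{-1}h}(g^{-1}x)$. $W_{00}(G,X)\subseteq V$ is the subspace of finitely supported $f:G\to C(X)$ such that $\sum_{g\in G}f_g=c\,1_X$ for some $c\in\mathbb{R}$ depending on $f$. $W_0(G,X)$ is the closure of $W_{00}(G,X)$ in $V$; it is $G$-invariant. The map $\pi:W_{00}(G,X)\to\mathbb{R}$ is defined by $\sum_{g\in G}f_g=\pi(f)1_X$; it is continuous and is extended by continuity to $\pi\in W_0(G,X)^*$. $G$ acts on the dual by $\langle g\varphi,v\rangle=\langle\varphi,g^{-1}v\rangle$. The action of $G$ on $X$ is called (topologically) amenable if there exists a sequence $f^n\in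 W_{00}(G,X)$, $n\in\mathbb{N}$, such that (1) $f^n_g\ge 0$ for every $n$ and every $g\in G$; (2) $\pi(f^n)=1$ for every $n$; (3) for each $g\in G$, $\|f^n-gf^n\|_V\to 0$ as $n\to\infty$. A mean for the action is an element $\mu\in W_0(G,X)^{**}$ with $\mu(\pi)=1$; it is invariant if $\mu(g\varphi)=\mu(\varphi)$ for every $g\in G$ and $\varphi\in W_0(G,X)^*$. *)

theory Defs
  imports "HOL-Analysis.Analysis"
begin

text \<open>
  A discrete group is a type of class \<open>group_add\<close>, the class of arbitrary (not necessarily
  commutative) groups in additive notation: $gh$ is \<open>g + h\<close> and $g^{-1}$ is \<open>- g\<close>.
  For compact \<open>X\<close> the type \<open>'x \<Rightarrow>\<^sub>C real\<close> of bounded continuous functions with the supremum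
  norm is $C(X)$; compactness of \<open>X\<close> is a hypothesis of the theorem, not of the definitions.
\<close>

locale homeo_action =
  fixes \<alpha> :: "'g::group_add \<Rightarrow> 'x::topological_space \<Rightarrow> 'x"
  assumes act_zero: "\<alpha> 0 x = x"
    and act_add: "\<alpha> (g + h) x = \<alpha> g (\<alpha> h x)"
    and act_homeo: "homeomorphism UNIV UNIV (\<alpha> g) (\<alpha> (- g))"
begin

lemma act_continuous: "continuous_on UNIV (\<alpha> g)"
  using act_homeo[of g] by (simp add: homeomorphism_def)

lemma act_uminus_left [simp]: "\<alpha> (- g) (\<alpha> g x) = x"
  by (metis act_add act_zero left_minus)

lemma act_uminus_right [simp]: "\<alpha> g (\<alpha> (- g) x) = x"
  by (metis act_add act_zero right_minus)

lemma range_act: "range (\<alpha> g) = UNIV"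
  by (metis act_uminus_right surjI)

end

definition C_act :: "('g::group_add \<Rightarrow> 'x::topological_space \<Rightarrow> 'x) \<Rightarrow> 'g \<Rightarrow> ('x \<Rightarrow>\<^sub>C real) \<Rightarrow> ('x \<Rightarrow>\<^sub>C real)"
  where "C_act \<alpha> g t = Bcontfun (\<lambda>x. t (\<alpha> (- g) x))"

lemma (in homeo_action) C_act_apply [simp]: "C_act \<alpha> g t x = t (\<alpha> (- g) x)"
proof -
  have "continuous_on UNIV (\<lambda>x. t (\<alpha> (- g) x))"
    using continuous_on_compose2[OF continuous_on_apply_bcontfun act_continuous] by blast
  moreover have "bounded (range (\<lambda>x. t (\<alpha> (- g) x)))"
    by (rule bounded_subset[OF bounded_apply_bcontfun[of t]]) auto
  ultimately show ?thesis
    by (simp add: C_act_def Bcontfun_inverse bcontfun_def)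
qed

typedef (overloaded) ('g, 'x) V =
  "{f :: 'g \<Rightarrow> ('x::topological_space \<Rightarrow>\<^sub>C real).
      (\<forall>x. (\<lambda>g. \<bar>f g x\<bar>) summable_on UNIV) \<and> bdd_above (range (\<lambda>x. \<Sum>\<^sub>\<infinity>g. \<bar>f g x\<bar>))}"
  morphisms coeff Abs_V
  by (rule exI[of _ "\<lambda>_. 0"]) auto

setup_lifting type_definition_V

lemma V_eqI: "(\<And>g x. coeff f g x = coeff f' g x) \<Longrightarrow> f = f'"
  by (metis bcontfun_eqI coeff_inject ext)

lemma coeff_summable [simp]: "(\<lambda>g. \<bar>coeff f g x\<bar>) summable_on UNIV"
  and coeff_bdd: "bdd_above (range (\<lambda>x. \<Sum>\<^sub>\<infinity>g. \<bar>coeff f g x\<bar>))"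
  using coeff[of f] by auto

lemma coeff_summable' [simp]: "(\<lambda>g. coeff f g x) summable_on UNIV"
  by (rule summable_on_iff_abs_summable_on_real[THEN iffD2]) simp

lemma V_memI:
  fixes f :: "'g \<Rightarrow> ('x::topological_space \<Rightarrow>\<^sub>C real)"
  assumes "\<And>x. (\<lambda>g. \<bar>f g x\<bar>) summable_on UNIV" "\<And>x. (\<Sum>\<^sub>\<infinity>g. \<bar>f g x\<bar>) \<le> B"
  shows "(\<forall>x. (\<lambda>g. \<bar>f g x\<bar>) summable_on UNIV) \<and> bdd_above (range (\<lambda>x. \<Sum>\<^sub>\<infinity>g. \<bar>f g x\<bar>))"
  using assms by (auto simp: bdd_above_def)

instantiation V :: (type, topological_space) real_normed_vector
begin

definition norm_V :: "('a, 'b) V \<Rightarrow> real"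
  where "norm_V f = (SUP x. \<Sum>\<^sub>\<infinity>g. \<bar>coeff f g x\<bar>)"

lemma V_sum_le_norm: "(\<Sum>\<^sub>\<infinity>g. \<bar>coeff f g x\<bar>) \<le> norm f" for f :: "('a, 'b) V"
  unfolding norm_V_def by (rule cSUP_upper[OF _ coeff_bdd]) simp

lemma V_norm_leI: "(\<And>x. (\<Sum>\<^sub>\<infinity>g. \<bar>coeff f g x\<bar>) \<le> B) \<Longrightarrow> norm f \<le> B" for f :: "('a, 'b) V"
  unfolding norm_V_def by (rule cSUP_least) auto

lift_definition zero_V :: "('a, 'b) V" is "\<lambda>_. 0"
  by auto

lemma V_add_aux:
  fixes f f' :: "('a, 'b) V"
  shows "(\<lambda>g. \<bar>coeff f g x + coeff f' g x\<bar>) summable_on UNIV"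
    and "(\<Sum>\<^sub>\<infinity>g. \<bar>coeff f g x + coeff f' g x\<bar>) \<le> norm f + norm f'"
proof -
  have s: "(\<lambda>g. \<bar>coeff f g x\<bar> + \<bar>coeff f' g x\<bar>) summable_on UNIV"
    by (intro summable_on_add) simp_all
  have "(\<lambda>g. coeff f g x + coeff f' g x) summable_on UNIV"
    by (intro summable_on_add) simp_all
  then show s': "(\<lambda>g. \<bar>coeff f g x + coeff f' g x\<bar>) summable_on UNIV"
    by (simp only: summable_on_iff_abs_summable_on_real[symmetric] real_norm_def[symmetric])
  have "(\<Sum>\<^sub>\<infinity>g. \<bar>coeff f g x + coeff f' g x\<bar>) \<le> (\<Sum>\<^sub>\<infinity>g. \<bar>coeff f g x\<bar> + \<bar>coeff f' g x\<bar>)"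
    by (rule infsum_mono[OF s' s]) auto
  also have "\<dots> = (\<Sum>\<^sub>\<infinity>g. \<bar>coeff f g x\<bar>) + (\<Sum>\<^sub>\<infinity>g. \<bar>coeff f' g x\<bar>)"
    by (rule infsum_add) simp_all
  also have "\<dots> \<le> norm f + norm f'"
    by (intro add_mono V_sum_le_norm)
  finally show "(\<Sum>\<^sub>\<infinity>g. \<bar>coeff f g x + coeff f' g x\<bar>) \<le> norm f + norm f'" .
qed

lift_definition plus_V :: "('a, 'b) V \<Rightarrow> ('a, 'b) V \<Rightarrow> ('a, 'b) V" is "\<lambda>f f' g. f g + f' g"
  subgoal for f f'
    using V_add_aux[of "Abs_V f" _ "Abs_V f'"]
    by (intro V_memI[where B = "norm (Abs_V f) + norm (Abs_V f')"])
       (simp_all add: Abs_V_inverse plus_bcontfun.rep_eq)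
  done

lift_definition uminus_V :: "('a, 'b) V \<Rightarrow> ('a, 'b) V" is "\<lambda>f g. - f g"
  by (simp add: uminus_bcontfun.rep_eq)

definition minus_V :: "('a, 'b) V \<Rightarrow> ('a, 'b) V \<Rightarrow> ('a, 'b) V"
  where "minus_V f f' = f + - f'"

lemma V_scaleR_aux:
  fixes f :: "('a, 'b) V"
  shows "(\<lambda>g. \<bar>c * coeff f g x\<bar>) summable_on UNIV"
    and "(\<Sum>\<^sub>\<infinity>g. \<bar>c * coeff f g x\<bar>) \<le> \<bar>c\<bar> * norm f"
  using V_sum_le_norm[of f x]
  by (simp_all add: abs_mult infsum_cmult_right' summable_on_cmult_right mult_left_mono)

lift_definition scaleR_V :: "real \<Rightarrow> ('a, 'b) V \<Rightarrow> ('a, 'b) V" is "\<lambda>c f g. c *\<^sub>R f g"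
  subgoal for c f
    using V_scaleR_aux[of c "Abs_V f"]
    by (intro V_memI[where B = "\<bar>c\<bar> * norm (Abs_V f)"]) (simp_all add: Abs_V_inverse scaleR_bcontfun.rep_eq)
  done

definition dist_V :: "('a, 'b) V \<Rightarrow> ('a, 'b) V \<Rightarrow> real"
  where "dist_V f f' = norm (f - f')"

definition uniformity_V :: "(('a, 'b) V \<times> ('a, 'b) V) filter"
  where "uniformity_V = (INF e\<in>{0<..}. principal {(f, f'). dist f f' < e})"

definition open_V :: "('a, 'b) V set \<Rightarrow> bool"
  where "open_V S = (\<forall>x\<in>S. \<forall>\<^sub>F (x', y) in uniformity. x' = x \<longrightarrow> y \<in> S)"

definition sgn_V :: "('a, 'b) V \<Rightarrow> ('a, 'b) V"
  where "sgn_V f = inverse (norm f) *\<^sub>R f"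

instance
proof
  fix f f' f'' :: "('a, 'b) V" and c d :: real
  show "f + f' + f'' = f + (f' + f'')" "f + f' = f' + f" "0 + f = f" "- f + f = 0"
    "c *\<^sub>R (f + f') = c *\<^sub>R f + c *\<^sub>R f'" "(c + d) *\<^sub>R f = c *\<^sub>R f + d *\<^sub>R f"
    "c *\<^sub>R d *\<^sub>R f = (c * d) *\<^sub>R f" "1 *\<^sub>R f = f"
    by (transfer, simp add: algebra_simps)+
  show "norm (f + f') \<le> norm f + norm f'"
    by (rule V_norm_leI) (simp add: plus_V.rep_eq plus_bcontfun.rep_eq V_add_aux)
  show "norm (c *\<^sub>R f) = \<bar>c\<bar> * norm f"
  proof (rule antisym)
    show le: "norm (c *\<^sub>R f) \<le> \<bar>c\<bar> * norm f" for c and f :: "('a, 'b) V"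
      by (rule V_norm_leI)
         (simp add: scaleR_V.rep_eq V_scaleR_aux)
    show "\<bar>c\<bar> * norm f \<le> norm (c *\<^sub>R f)"
    proof (cases "c = 0")
      case True
      have "0 \<le> (\<Sum>\<^sub>\<infinity>g. \<bar>coeff (c *\<^sub>R f) g undefined\<bar>)" by (rule infsum_nonneg) simp
      also have "\<dots> \<le> norm (c *\<^sub>R f)" by (rule V_sum_le_norm)
      finally show ?thesis using True by simp
    next
      case False
      have "inverse c *\<^sub>R c *\<^sub>R f = f"
        using False by (transfer, simp)
      then have "norm f \<le> \<bar>inverse c\<bar> * norm (c *\<^sub>R f)"
        using le[of "inverse c" "c *\<^sub>R f"] by simp
      then show ?thesis
        using False by (simp add: field_simps)
    qed
  qed
  show "norm f = 0 \<longleftrightarrow> f = 0"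
  proof
    assume n: "norm f = 0"
    show "f = 0"
    proof (rule V_eqI)
      fix g x
      have "\<bar>coeff f g x\<bar> = infsum (\<lambda>g. \<bar>coeff f g x\<bar>) {g}" by simp
      also have "\<dots> \<le> (\<Sum>\<^sub>\<infinity>g. \<bar>coeff f g x\<bar>)"
        by (rule infsum_mono2) auto
      also have "\<dots> \<le> 0"
        using V_sum_le_norm[of f x] n by simp
      finally show "coeff f g x = coeff 0 g x"
        by (simp add: zero_V.rep_eq)
    qed
  qed (simp add: norm_V_def zero_V.rep_eq)
qed (simp_all add: minus_V_def dist_V_def uniformity_V_def open_V_def sgn_V_def)

end

lemma coeff_simps [simp]:
  "coeff 0 g = 0" "coeff (f + f') g = coeff f g + coeff f' g"
  "coeff (- f) g = - coeff f g" "coeff (f - f') g = coeff f g - coeff f' g"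
  "coeff (c *\<^sub>R f) g = c *\<^sub>R coeff f g"
  by (simp_all add: zero_V.rep_eq plus_V.rep_eq uminus_V.rep_eq scaleR_V.rep_eq)
    (simp add: minus_V_def plus_V.rep_eq uminus_V.rep_eq del: add_uminus_conv_diff)

definition V_act ::
    "('g::group_add \<Rightarrow> 'x::topological_space \<Rightarrow> 'x) \<Rightarrow> 'g \<Rightarrow> ('g, 'x) V \<Rightarrow> ('g, 'x) V"
  where "V_act \<alpha> g f = Abs_V (\<lambda>h. C_act \<alpha> g (coeff f (- g + h)))"

lemma bij_shift: "bij (\<lambda>h. - g + h :: 'g::group_add)"
  by (rule bij_betw_byWitness[where f' = "\<lambda>h. g + h"]) (auto simp: add.assoc[symmetric])

lemma shift_infsum:
  fixes f :: "('g::group_add, 'x::topological_space) V"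
  shows "(\<Sum>\<^sub>\<infinity>h. \<bar>coeff f (- g + h) x\<bar>) = (\<Sum>\<^sub>\<infinity>h. \<bar>coeff f h x\<bar>)"
  using infsum_reindex_bij_betw[OF bij_shift[of g], of "\<lambda>h. \<bar>coeff f h x\<bar>"] by simp

context homeo_action
begin

lemma coeff_V_act [simp]: "coeff (V_act \<alpha> g f) h = C_act \<alpha> g (coeff f (- g + h))"
proof -
  have "(\<lambda>h. \<bar>coeff f (- g + h) x\<bar>) summable_on UNIV" for x
    using summable_on_reindex_bij_betw[OF bij_shift[of g], of "\<lambda>h. \<bar>coeff f h x\<bar>"] by simp
  then have "(\<lambda>h. C_act \<alpha> g (coeff f (- g + h))) \<in>
      {f :: 'g \<Rightarrow> ('x \<Rightarrow>\<^sub>C real).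
        (\<forall>x. (\<lambda>g. \<bar>f g x\<bar>) summable_on UNIV) \<and> bdd_above (range (\<lambda>x. \<Sum>\<^sub>\<infinity>g. \<bar>f g x\<bar>))}"
    by (intro CollectI V_memI[where B = "norm f"]) (simp_all add: shift_infsum V_sum_le_norm)
  then show ?thesis
    unfolding V_act_def by (simp only: Abs_V_inverse)
qed

lemma V_act_linear: "linear (V_act \<alpha> g)"
  by (rule linearI; rule V_eqI;
      simp only: coeff_V_act coeff_simps C_act_apply plus_bcontfun.rep_eq scaleR_bcontfun.rep_eq)

lemma V_act_norm: "norm (V_act \<alpha> g f) = norm f"
proof -
  have "norm (V_act \<alpha> g f) = (SUP x. \<Sum>\<^sub>\<infinity>h. \<bar>coeff f h (\<alpha> (- g) x)\<bar>)"
    unfolding norm_V_def coeff_V_act C_act_apply shift_infsum ..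
  also have "\<dots> = Sup ((\<lambda>y. \<Sum>\<^sub>\<infinity>h. \<bar>coeff f h y\<bar>) ` range (\<alpha> (- g)))"
    unfolding image_image ..
  finally show ?thesis
    unfolding range_act norm_V_def .
qed

lemma V_act_continuous: "continuous_on S (V_act \<alpha> g)"
proof -
  have "bounded_linear (V_act \<alpha> g)"
    by (rule bounded_linear_intro[where K = 1])
       (simp_all add: V_act_norm linear_add[OF V_act_linear] linear_scale[OF V_act_linear])
  then show ?thesis
    by (rule linear_continuous_on)
qed

end

definition W00 :: "('g, 'x::topological_space) V set"
  where "W00 = {f. finite {g. coeff f g \<noteq> 0} \<and>
    (\<exists>c::real. (\<Sum>g | coeff f g \<noteq> 0. coeff f g) = const_bcontfun c)}"

definition pi00 :: "('g, 'x::topological_space) V \<Rightarrow> real"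
  where "pi00 f = (THE c. (\<Sum>g | coeff f g \<noteq> 0. coeff f g) = const_bcontfun c)"

lemma apply_bcontfun_sum: "apply_bcontfun (sum f A) x = (\<Sum>a\<in>A. apply_bcontfun (f a) x)"
  for f :: "'a \<Rightarrow> ('x::topological_space \<Rightarrow>\<^sub>C real)"
  by (induction A rule: infinite_finite_induct) (simp_all add: plus_bcontfun.rep_eq)

lemma infsum_coeff_finite:
  assumes "finite {g. coeff f g \<noteq> 0}"
  shows "(\<Sum>\<^sub>\<infinity>g. coeff f g x) = apply_bcontfun (\<Sum>g | coeff f g \<noteq> 0. coeff f g) x"
proof -
  have "(\<Sum>\<^sub>\<infinity>g. coeff f g x) = infsum (\<lambda>g. coeff f g x) {g. coeff f g \<noteq> 0}"
    by (rule infsum_cong_neutral) auto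
  then show ?thesis
    using assms by (simp add: apply_bcontfun_sum)
qed

lemma W00_iff:
  "f \<in> W00 \<longleftrightarrow> finite {g. coeff f g \<noteq> 0} \<and> (\<exists>c. \<forall>x. (\<Sum>\<^sub>\<infinity>g. coeff f g x) = c)"
proof (cases "finite {g. coeff f g \<noteq> 0}")
  case True
  have "(\<Sum>g | coeff f g \<noteq> 0. coeff f g) = const_bcontfun c \<longleftrightarrow> (\<forall>x. (\<Sum>\<^sub>\<infinity>g. coeff f g x) = c)" for c
    unfolding infsum_coeff_finite[OF True]
    by (auto simp: const_bcontfun.rep_eq intro: bcontfun_eqI)
  then show ?thesis
    unfolding W00_def mem_Collect_eq by (simp only:)
qed (simp add: W00_def)

lemma W00I: "finite {g. coeff f g \<noteq> 0} \<Longrightarrow> (\<And>x. (\<Sum>\<^sub>\<infinity>g. coeff f g x) = c) \<Longrightarrow> f \<in> W00"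
  unfolding W00_iff by blast

lemma const_bcontfun_eq: "(F :: 'x::topological_space \<Rightarrow>\<^sub>C real) = const_bcontfun c \<Longrightarrow> F = const_bcontfun d \<Longrightarrow> d = c"
  using const_bcontfun.rep_eq[of c, where ?'a = 'x] const_bcontfun.rep_eq[of d, where ?'a = 'x] by metis

lemma pi00_sum:
  assumes "f \<in> W00"
  shows "(\<Sum>g | coeff f g \<noteq> 0. coeff f g) = const_bcontfun (pi00 f)"
proof -
  obtain c where c: "(\<Sum>g | coeff f g \<noteq> 0. coeff f g) = const_bcontfun c"
    using assms by (auto simp: W00_def)
  show ?thesis
    unfolding pi00_def by (rule theI[of _ c]) (fact c, use c const_bcontfun_eq in blast)
qed

lemma pi00_infsum: "f \<in> W00 \<Longrightarrow> pi00 f = (\<Sum>\<^sub>\<infinity>g. coeff f g x)"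
  using infsum_coeff_finite[of f x]
  by (simp only: pi00_sum const_bcontfun.rep_eq W00_iff)

lemma subspace_W00: "subspace (W00 :: ('g, 'x::topological_space) V set)"
proof (rule subspaceI)
  show "0 \<in> (W00 :: ('g, 'x) V set)"
    by (simp add: W00_iff)
next
  fix f f' :: "('g, 'x) V" assume ff': "f \<in> W00" "f' \<in> W00"
  have "finite {g. coeff (f + f') g \<noteq> 0}"
    by (rule finite_subset[of _ "{g. coeff f g \<noteq> 0} \<union> {g. coeff f' g \<noteq> 0}"])
       (use ff' in \<open>auto simp: W00_def\<close>)
  moreover have "(\<Sum>\<^sub>\<infinity>g. coeff (f + f') g x) = pi00 f + pi00 f'" for x
    using pi00_infsum[OF ff'(1), of x] pi00_infsum[OF ff'(2), of x]
    by (simp add: plus_bcontfun.rep_eq infsum_add)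
  ultimately show "f + f' \<in> W00"
    by (rule W00I)
next
  fix c and f :: "('g, 'x) V" assume f: "f \<in> W00"
  have "finite {g. coeff (c *\<^sub>R f) g \<noteq> 0}"
    by (rule finite_subset[of _ "{g. coeff f g \<noteq> 0}"]) (use f in \<open>auto simp: W00_def\<close>)
  moreover have "(\<Sum>\<^sub>\<infinity>g. coeff (c *\<^sub>R f) g x) = c * pi00 f" for x
    using pi00_infsum[OF f, of x] by (simp add: infsum_cmult_right')
  ultimately show "c *\<^sub>R f \<in> W00"
    by (rule W00I)
qed

lemma subspace_closure_W00: "subspace (closure W00)"
proof (rule subspaceI)
  show "0 \<in> closure W00"
    using subspace_0[OF subspace_W00] closure_subset by blast
next
  fix f f' :: "('g, 'x::topological_space) V" assume "f \<in> closure W00" "f' \<in> closure W00"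
  then obtain u u' where "\<And>n. u n \<in> W00" "u \<longlonglongrightarrow> f" "\<And>n. u' n \<in> W00" "u' \<longlonglongrightarrow> f'"
    by (metis closure_sequential)
  then show "f + f' \<in> closure W00"
    unfolding closure_sequential
    by (intro exI[of _ "\<lambda>n. u n + u' n"]) (simp add: tendsto_add subspace_add[OF subspace_W00])
next
  fix c and f :: "('g, 'x::topological_space) V" assume "f \<in> closure W00"
  then obtain u where "\<And>n. u n \<in> W00" "u \<longlonglongrightarrow> f"
    by (metis closure_sequential)
  then show "c *\<^sub>R f \<in> closure W00"
    unfolding closure_sequential
    by (intro exI[of _ "\<lambda>n. c *\<^sub>R u n"])
       (simp add: tendsto_scaleR subspace_scale[OF subspace_W00])
qed

typedef (overloaded) ('g, 'x) W0 = "closure (W00 :: ('g, 'x::topological_space) V set)"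
  using subspace_0[OF subspace_closure_W00] by blast

setup_lifting type_definition_W0

text \<open>With the norm inherited from \<open>V\<close>, the dual $W_0(G,X)^*$ is \<open>('g, 'x) W0 \<Rightarrow>\<^sub>L real\<close> and the
  bidual is \<open>(('g, 'x) W0 \<Rightarrow>\<^sub>L real) \<Rightarrow>\<^sub>L real\<close>.\<close>

instantiation W0 :: (type, topological_space) real_normed_vector
begin

lift_definition zero_W0 :: "('a, 'b) W0" is 0
  by (rule subspace_0[OF subspace_closure_W00])
lift_definition plus_W0 :: "('a, 'b) W0 \<Rightarrow> ('a, 'b) W0 \<Rightarrow> ('a, 'b) W0" is "(+)"
  by (rule subspace_add[OF subspace_closure_W00])
lift_definition uminus_W0 :: "('a, 'b) W0 \<Rightarrow> ('a, 'b) W0" is uminus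
  by (rule subspace_neg[OF subspace_closure_W00])
lift_definition minus_W0 :: "('a, 'b) W0 \<Rightarrow> ('a, 'b) W0 \<Rightarrow> ('a, 'b) W0" is "(-)"
  by (rule subspace_diff[OF subspace_closure_W00])
lift_definition scaleR_W0 :: "real \<Rightarrow> ('a, 'b) W0 \<Rightarrow> ('a, 'b) W0" is "(*\<^sub>R)"
  by (rule subspace_scale[OF subspace_closure_W00])
lift_definition norm_W0 :: "('a, 'b) W0 \<Rightarrow> real" is norm .

definition dist_W0 :: "('a, 'b) W0 \<Rightarrow> ('a, 'b) W0 \<Rightarrow> real"
  where "dist_W0 v w = norm (v - w)"

definition uniformity_W0 :: "(('a, 'b) W0 \<times> ('a, 'b) W0) filter"
  where "uniformity_W0 = (INF e\<in>{0<..}. principal {(v, w). dist v w < e})"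

definition open_W0 :: "('a, 'b) W0 set \<Rightarrow> bool"
  where "open_W0 S = (\<forall>x\<in>S. \<forall>\<^sub>F (x', y) in uniformity. x' = x \<longrightarrow> y \<in> S)"

definition sgn_W0 :: "('a, 'b) W0 \<Rightarrow> ('a, 'b) W0"
  where "sgn_W0 v = inverse (norm v) *\<^sub>R v"

instance
proof
  fix u v w :: "('a, 'b) W0" and c d :: real
  show "u + v + w = u + (v + w)" "u + v = v + u" "0 + u = u" "- u + u = 0" "u - v = u + - v"
    "c *\<^sub>R (u + v) = c *\<^sub>R u + c *\<^sub>R v" "(c + d) *\<^sub>R u = c *\<^sub>R u + d *\<^sub>R u"
    "c *\<^sub>R d *\<^sub>R u = (c * d) *\<^sub>R u" "1 *\<^sub>R u = u"
    "norm u = 0 \<longleftrightarrow> u = 0" "norm (u + v) \<le> norm u + norm v" "norm (c *\<^sub>R u) = \<bar>c\<bar> * norm u"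
    by (transfer, simp add: algebra_simps norm_triangle_ineq)+
qed (simp_all add: dist_W0_def uniformity_W0_def open_W0_def sgn_W0_def)

end

text \<open>The unique continuous linear extension of \<open>pi00\<close> to \<open>W0\<close>; existence and uniqueness are
  \<open>piW_exists\<close> and \<open>W0_functional_unique\<close>.\<close>

definition piW :: "('g, 'x::topological_space) W0 \<Rightarrow>\<^sub>L real"
  where "piW = (THE p. \<forall>f\<in>W00. blinfun_apply p (Abs_W0 f) = pi00 f)"

lemma W0_dense:
  fixes w :: "('g, 'x::topological_space) W0"
  obtains u where "\<And>n. u n \<in> W00" "(\<lambda>n. Abs_W0 (u n)) \<longlonglongrightarrow> w"
proof -
  obtain u where u: "\<And>n. u n \<in> W00" "u \<longlonglongrightarrow> Rep_W0 w"
    using Rep_W0[of w] by (auto simp: closure_sequential)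
  have "norm (Abs_W0 (u n) - w) = norm (u n - Rep_W0 w)" for n
    using u(1)[of n] closure_subset[of "W00 :: ('g, 'x) V set"]
    by (simp add: norm_W0.rep_eq minus_W0.rep_eq Abs_W0_inverse subset_iff)
  then have "(\<lambda>n. Abs_W0 (u n)) \<longlonglongrightarrow> w"
    using u(2) by (simp add: tendsto_iff dist_norm)
  with u(1) show ?thesis
    by (rule that)
qed

lemma W0_functional_unique:
  fixes p q :: "('g, 'x::topological_space) W0 \<Rightarrow>\<^sub>L real"
  assumes "\<And>f. f \<in> W00 \<Longrightarrow> p (Abs_W0 f) = q (Abs_W0 f)"
  shows "p = q"
proof (rule blinfun_eqI)
  fix w :: "('g, 'x) W0"
  obtain u where u: "\<And>n. u n \<in> W00" "(\<lambda>n. Abs_W0 (u n)) \<longlonglongrightarrow> w"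
    using W0_dense[of w] by blast
  have "(\<lambda>n. p (Abs_W0 (u n))) \<longlonglongrightarrow> p w" "(\<lambda>n. q (Abs_W0 (u n))) \<longlonglongrightarrow> q w"
    by (auto intro!: tendsto_intros u)
  then show "p w = q w"
    using assms[OF u(1)] LIMSEQ_unique by auto
qed

lemma piW_exists:
  "\<exists>p. \<forall>f\<in>W00. blinfun_apply p (Abs_W0 f :: ('g, 'x::topological_space) W0) = pi00 f"
proof -
  define P where "P w = (\<Sum>\<^sub>\<infinity>g. coeff (Rep_W0 w) g undefined)" for w :: "('g, 'x) W0"
  have "bounded_linear P"
  proof (rule bounded_linear_intro[where K = 1])
    fix v w :: "('g, 'x) W0" and c
    show "P (v + w) = P v + P w"
      by (simp add: P_def plus_W0.rep_eq plus_bcontfun.rep_eq infsum_add)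
    show "P (c *\<^sub>R v) = c *\<^sub>R P v"
      by (simp add: P_def scaleR_W0.rep_eq infsum_cmult_right')
    have "norm (P v) \<le> (\<Sum>\<^sub>\<infinity>g. norm (coeff (Rep_W0 v) g undefined))"
      unfolding P_def by (rule norm_infsum_bound) simp
    also have "\<dots> \<le> norm (Rep_W0 v)"
      using V_sum_le_norm[of "Rep_W0 v"] by simp
    finally show "norm (P v) \<le> norm v * 1"
      by (simp add: norm_W0.rep_eq)
  qed
  moreover have "P (Abs_W0 f) = pi00 f" if "f \<in> W00" for f
    using that closure_subset[of "W00 :: ('g, 'x) V set"]
    by (auto simp: P_def Abs_W0_inverse pi00_infsum[OF that, of undefined] subset_iff)
  ultimately show ?thesis
    by (intro exI[of _ "Blinfun P"]) (simp add: bounded_linear_Blinfun_apply)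
qed

lemma piW_apply: "f \<in> W00 \<Longrightarrow> piW (Abs_W0 f) = pi00 f"
proof -
  assume f: "f \<in> W00"
  obtain p :: "('a, 'b) W0 \<Rightarrow>\<^sub>L real" where p: "\<forall>f\<in>W00. p (Abs_W0 f) = pi00 f"
    using piW_exists by blast
  have "\<forall>f\<in>W00. piW (Abs_W0 f :: ('a, 'b) W0) = pi00 f"
    unfolding piW_def
  proof (rule theI[of _ p])
    fix q :: "('a, 'b) W0 \<Rightarrow>\<^sub>L real" assume "\<forall>f\<in>W00. q (Abs_W0 f) = pi00 f"
    with p show "q = p"
      by (intro W0_functional_unique) simp
  qed (fact p)
  with f show ?thesis by blast
qed

definition W0_act ::
    "('g::group_add \<Rightarrow> 'x::topological_space \<Rightarrow> 'x) \<Rightarrow> 'g \<Rightarrow> ('g, 'x) W0 \<Rightarrow> ('g, 'x) W0"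
  where "W0_act \<alpha> g w = Abs_W0 (V_act \<alpha> g (Rep_W0 w))"

definition dual_act ::
    "('g::group_add \<Rightarrow> 'x::topological_space \<Rightarrow> 'x) \<Rightarrow> 'g \<Rightarrow>
      (('g, 'x) W0 \<Rightarrow>\<^sub>L real) \<Rightarrow> (('g, 'x) W0 \<Rightarrow>\<^sub>L real)"
  where "dual_act \<alpha> g \<phi> = Blinfun (\<lambda>w. \<phi> (W0_act \<alpha> (- g) w))"

context homeo_action
begin

lemma V_act_W00: "f \<in> W00 \<Longrightarrow> V_act \<alpha> g f \<in> W00"
proof -
  assume f: "f \<in> W00"
  have "{h. coeff (V_act \<alpha> g f) h \<noteq> 0} \<subseteq> (\<lambda>h. g + h) ` {h. coeff f h \<noteq> 0}"
  proof safe
    fix h assume "coeff (V_act \<alpha> g f) h \<noteq> 0"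
    then have "coeff f (- g + h) \<noteq> 0"
      by (auto intro: bcontfun_eqI)
    then show "h \<in> (\<lambda>h. g + h) ` {h. coeff f h \<noteq> 0}"
      by (intro image_eqI[of _ _ "- g + h"]) (auto simp: add.assoc[symmetric])
  qed
  then have "finite {h. coeff (V_act \<alpha> g f) h \<noteq> 0}"
    by (rule finite_subset) (use f in \<open>simp add: W00_def\<close>)
  moreover have "(\<Sum>\<^sub>\<infinity>h. coeff (V_act \<alpha> g f) h x) = pi00 f" for x
    using infsum_reindex_bij_betw[OF bij_shift[of g], of "\<lambda>h. coeff f h (\<alpha> (- g) x)"]
    by (simp add: pi00_infsum[OF f, of "\<alpha> (- g) x"])
  ultimately show ?thesis
    by (rule W00I)
qed

lemma V_act_closure: "f \<in> closure W00 \<Longrightarrow> V_act \<alpha> g f \<in> closure W00"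
proof -
  have "V_act \<alpha> g ` closure W00 \<subseteq> closure W00"
    by (rule image_closure_subset[OF V_act_continuous closed_closure])
       (use V_act_W00 closure_subset in blast)
  then show "f \<in> closure W00 \<Longrightarrow> V_act \<alpha> g f \<in> closure W00"
    by blast
qed

lemma Rep_W0_act: "Rep_W0 (W0_act \<alpha> g w) = V_act \<alpha> g (Rep_W0 w)"
  by (simp add: W0_act_def Abs_W0_inverse V_act_closure Rep_W0)

lemma W0_act_bounded_linear: "bounded_linear (W0_act \<alpha> g)"
  by (rule bounded_linear_intro[where K = 1])
     (auto simp: Rep_W0_inject[symmetric] Rep_W0_act plus_W0.rep_eq scaleR_W0.rep_eq norm_W0.rep_eq
        V_act_norm linear_add[OF V_act_linear] linear_scale[OF V_act_linear])

lemma dual_act_apply: "dual_act \<alpha> g \<phi> w = \<phi> (W0_act \<alpha> (- g) w)"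
  unfolding dual_act_def
  by (simp add: bounded_linear_Blinfun_apply
      bounded_linear_compose[OF blinfun.bounded_linear_right W0_act_bounded_linear])

end

definition amenable_action :: "('g::group_add \<Rightarrow> 'x::topological_space \<Rightarrow> 'x) \<Rightarrow> bool"
  where "amenable_action \<alpha> \<longleftrightarrow>
    (\<exists>f :: nat \<Rightarrow> ('g, 'x) V.
      (\<forall>n. f n \<in> W00) \<and>
      (\<forall>n g x. coeff (f n) g x \<ge> 0) \<and>
      (\<forall>n. pi00 (f n) = 1) \<and>
      (\<forall>g. (\<lambda>n. norm (f n - V_act \<alpha> g (f n))) \<longlonglongrightarrow> 0))"

definition is_mean :: "((('g, 'x::topological_space) W0 \<Rightarrow>\<^sub>L real) \<Rightarrow>\<^sub>L real) \<Rightarrow> bool"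
  where "is_mean \<mu> \<longleftrightarrow> \<mu> piW = 1"

definition invariant_mean ::
    "('g::group_add \<Rightarrow> 'x::topological_space \<Rightarrow> 'x) \<Rightarrow>
      ((('g, 'x) W0 \<Rightarrow>\<^sub>L real) \<Rightarrow>\<^sub>L real) \<Rightarrow> bool"
  where "invariant_mean \<alpha> \<mu> \<longleftrightarrow> is_mean \<mu> \<and> (\<forall>g \<phi>. \<mu> (dual_act \<alpha> g \<phi>) = \<mu> \<phi>)"

end

theory Submission
  imports Defs
begin

text \<open>
  Amenability gives unit vectors in \<open>W0\<close>, and a linear functional on the dual dominated by the upper
  limit along that sequence is an invariant mean.

  Conversely, if no finitely supported \<open>f\<close> with \<open>pi00 f = 1\<close> were almost invariant under finitely
  many group elements, Hahn-Banach would give a functional \<open>\<psi>\<close> that vanishes on the kernel of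
  \<open>piW\<close>, hence is a nonzero multiple of \<open>piW\<close>, and is a sum of differences
  \<open>\<phi> - g \<phi>\<close>, which an invariant mean kills. Positivity costs a factor 2 only: since the
  coefficients of \<open>f\<close> sum to 1, the sum of their absolute values is at least 1 everywhere, so
  dividing by it is harmless.
\<close>

section \<open>Sublinear functionals and the Hahn-Banach theorem\<close>

definition sublinear :: "('a::real_vector \<Rightarrow> real) \<Rightarrow> bool"
  where "sublinear p \<longleftrightarrow> (\<forall>x y. p (x + y) \<le> p x + p y) \<and> (\<forall>t>0. \<forall>x. p (t *\<^sub>R x) = t * p x)"

lemma sublinearD:
  assumes "sublinear p"
  shows sublinear_add: "p (x + y) \<le> p x + p y"
    and sublinear_zero: "p 0 = 0"
    and sublinear_scale: "0 \<le> t \<Longrightarrow> p (t *\<^sub>R x) = t * p x"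
    and sublinear_minus: "- p (- x) \<le> p x"
proof -
  show "p (x + y) \<le> p x + p y" for x y
    using assms by (simp add: sublinear_def)
  note add = this
  have scale: "t > 0 \<Longrightarrow> p (t *\<^sub>R x) = t * p x" for t x
    using assms by (simp add: sublinear_def)
  show zero: "p 0 = 0"
    using scale[of 2 0] by simp
  show "0 \<le> t \<Longrightarrow> p (t *\<^sub>R x) = t * p x"
    using scale[of t x] zero by (cases "t = 0") auto
  show "- p (- x) \<le> p x"
    using add[of x "- x"] zero by simp
qed

text \<open>Common source of the sublinear functionals below: the minorant at a point, the infimum
  of a chain, the distance to a subspace and the upper limit all arise as infima of sets of
  candidate values \<open>A x\<close> that can be added and scaled without loss.\<close>

lemma sublinear_Inf:
  fixes A :: "'a::real_vector \<Rightarrow> real set"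
  assumes ne: "\<And>x. A x \<noteq> {}" and bdd: "\<And>x. bdd_below (A x)"
    and add: "\<And>x y c d. c \<in> A x \<Longrightarrow> d \<in> A y \<Longrightarrow> \<exists>e\<in>A (x + y). e \<le> c + d"
    and scale: "\<And>x c t. c \<in> A x \<Longrightarrow> 0 < t \<Longrightarrow> \<exists>e\<in>A (t *\<^sub>R x). e \<le> t * c"
  shows "sublinear (\<lambda>x. Inf (A x))"
proof -
  have lower: "Inf (A x) \<le> e" if "e \<in> A x" for e x
    by (rule cInf_lower[OF that bdd])
  have "Inf (A (x + y)) \<le> Inf (A x) + Inf (A y)" for x y
  proof -
    have "Inf (A (x + y)) - c \<le> Inf (A y)" if "c \<in> A x" for c
    proof (rule cInf_greatest[OF ne])
      fix d assume "d \<in> A y"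
      with add[OF that] obtain e where "e \<in> A (x + y)" "e \<le> c + d" by blast
      with lower[of e "x + y"] show "Inf (A (x + y)) - c \<le> d" by simp
    qed
    then have "Inf (A (x + y)) - Inf (A y) \<le> Inf (A x)"
      by (intro cInf_greatest[OF ne]) (simp add: algebra_simps)
    then show ?thesis by simp
  qed
  moreover have scale_le: "Inf (A (t *\<^sub>R x)) \<le> t * Inf (A x)" if "0 < t" for t x
  proof -
    have "Inf (A (t *\<^sub>R x)) / t \<le> Inf (A x)"
    proof (rule cInf_greatest[OF ne])
      fix c assume "c \<in> A x"
      with scale[OF _ that] obtain e where "e \<in> A (t *\<^sub>R x)" "e \<le> t * c" by blast
      with lower[of e "t *\<^sub>R x"] that show "Inf (A (t *\<^sub>R x)) / t \<le> c"
        by (simp add: field_simps)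
    qed
    with that show ?thesis by (simp add: field_simps)
  qed
  \<comment> \<open>Scaling back by \<open>inverse t\<close> turns the inequality just proved into
    its converse.\<close>
  moreover have "t * Inf (A x) \<le> Inf (A (t *\<^sub>R x))" if "0 < t" for t x
    using scale_le[of "inverse t" "t *\<^sub>R x"] that by (simp add: field_simps)
  ultimately show ?thesis
    by (auto simp: sublinear_def intro: antisym)
qed

text \<open>The minorant is the infimum of \<open>p (x + t *\<^sub>R v) - t * p v\<close> over
  \<open>t \<ge> 0\<close>. The choice \<open>t = 0\<close> puts it below \<open>p\<close>, and
  \<open>t = 1\<close> gives the value at \<open>- v\<close>; subadditivity bounds it below by
  \<open>- p (- x)\<close>.\<close>

lemma sublinear_minorant_at:
  assumes p: "sublinear p"
  obtains q where "sublinear q" "\<And>x. q x \<le> p x" "q (- v) = - p v"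
proof
  define A where "A x = {p (x + t *\<^sub>R v) - t * p v |t. 0 \<le> t}" for x
  have lb: "- p (- x) \<le> c" if c: "c \<in> A x" for c x
  proof -
    obtain t where t: "0 \<le> t" "c = p (x + t *\<^sub>R v) - t * p v"
      using c by (auto simp: A_def)
    have "t * p v \<le> p (x + t *\<^sub>R v) + p (- x)"
      using sublinear_add[OF p, of "x + t *\<^sub>R v" "- x"] sublinear_scale[OF p t(1), of v] by simp
    with t show ?thesis by simp
  qed
  then have bdd: "bdd_below (A x)" for x
    by (auto simp: bdd_below_def)
  show "sublinear (\<lambda>x. Inf (A x))"
  proof (rule sublinear_Inf[OF _ bdd])
    show "A x \<noteq> {}" for x
      by (auto simp: A_def)
  next
    fix x y c d assume "c \<in> A x" "d \<in> A y"
    then obtain s t where st: "0 \<le> s" "c = p (x + s *\<^sub>R v) - s * p v"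
        "0 \<le> t" "d = p (y + t *\<^sub>R v) - t * p v"
      by (auto simp: A_def)
    have "p (x + y + (s + t) *\<^sub>R v) \<le> p (x + s *\<^sub>R v) + p (y + t *\<^sub>R v)"
      using sublinear_add[OF p, of "x + s *\<^sub>R v" "y + t *\<^sub>R v"] by (simp add: algebra_simps)
    with st show "\<exists>e\<in>A (x + y). e \<le> c + d"
      by (intro bexI[of _ "p (x + y + (s + t) *\<^sub>R v) - (s + t) * p v"])
         (auto simp: A_def algebra_simps intro!: exI[of _ "s + t"])
  next
    fix x c and t :: real assume "c \<in> A x" "0 < t"
    then obtain s where s: "0 \<le> s" "c = p (x + s *\<^sub>R v) - s * p v"
      by (auto simp: A_def)
    have "t * c = p (t *\<^sub>R x + (t * s) *\<^sub>R v) - (t * s) * p v"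
      using sublinear_scale[OF p, of t "x + s *\<^sub>R v"] \<open>0 < t\<close>
      by (simp add: s(2) right_diff_distrib scaleR_add_right)
    with \<open>0 < t\<close> s show "\<exists>e\<in>A (t *\<^sub>R x). e \<le> t * c"
      by (intro bexI[of _ "t * c"]) (auto simp: A_def intro!: exI[of _ "t * s"])
  qed
  show "Inf (A x) \<le> p x" for x
    by (rule cInf_lower[OF _ bdd]) (auto simp: A_def intro!: exI[of _ 0])
  show "Inf (A (- v)) = - p v"
  proof (rule antisym)
    show "Inf (A (- v)) \<le> - p v"
      by (rule cInf_lower[OF _ bdd])
         (auto simp: A_def sublinear_zero[OF p] intro!: exI[of _ 1])
    show "- p v \<le> Inf (A (- v))"
      by (rule cInf_greatest) (use lb[of _ "- v"] in \<open>auto simp: A_def\<close>)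
  qed
qed

text \<open>Zorn's lemma for the reversed pointwise order: a chain has its pointwise infimum as a
  bound, which is finite because every member lies above \<open>- p (- x)\<close>.\<close>

lemma minimal_sublinear:
  assumes p: "sublinear p"
  obtains m where "sublinear m" "\<And>x. m x \<le> p x"
    "\<And>q. sublinear q \<Longrightarrow> (\<And>x. q x \<le> m x) \<Longrightarrow> q = m"
proof -
  define S where "S = {q. sublinear q \<and> (\<forall>x. q x \<le> p x)}"
  have "\<exists>m\<in>S. \<forall>q\<in>S. m \<ge> q \<longrightarrow> q = m"
  proof (rule predicate_Zorn)
    show "partial_order_on S (relation_of (\<ge>) S)"
      by (rule partial_order_on_relation_ofI) auto
  next
    fix C assume "C \<in> Chains (relation_of (\<ge>) S)"
    then have CS: "C \<subseteq> S" and chain: "\<And>q r. q \<in> C \<Longrightarrow> r \<in> C \<Longrightarrow> q \<le> r \<or> r \<le> q"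
      by (auto simp: Chains_def relation_of_def)
    show "\<exists>u\<in>S. \<forall>a\<in>C. a \<ge> u"
    proof (cases "C = {}")
      case True
      then show ?thesis using p by (auto simp: S_def)
    next
      case False
      have sub: "sublinear q" "q x \<le> p x" if "q \<in> C" for q x
        using CS that by (auto simp: S_def)
      define A where "A x = (\<lambda>q. q x) ` C" for x
      have bdd: "bdd_below (A x)" for x
        unfolding A_def
      proof (rule bdd_belowI2)
        fix q assume q: "q \<in> C"
        show "- p (- x) \<le> q x"
          using sublinear_minus[OF sub(1)[OF q], of x] sub(2)[OF q, of "- x"] by simp
      qed
      have "sublinear (\<lambda>x. Inf (A x))"
      proof (rule sublinear_Inf[OF _ bdd])
        show "A x \<noteq> {}" for x
          using False by (simp add: A_def)
      next
        fix x y c d assume "c \<in> A x" "d \<in> A y"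
        then obtain q r where qr: "q \<in> C" "c = q x" "r \<in> C" "d = r y"
          by (auto simp: A_def)
        \<comment> \<open>Two members of a chain are comparable, so the lower one serves at both
          points and its own subadditivity finishes.\<close>
        then have "min q r \<in> C" and "min q r x \<le> c" "min q r y \<le> d"
          using chain[of q r] by (auto simp: min_def le_fun_def)
        moreover from this have "min q r (x + y) \<le> min q r x + min q r y"
          by (intro sublinear_add sub)
        ultimately show "\<exists>e\<in>A (x + y). e \<le> c + d"
          unfolding A_def by (intro bexI[of _ "min q r (x + y)"]) (linarith, rule imageI)
      next
        fix x c and t :: real assume "c \<in> A x" "0 < t"
        then show "\<exists>e\<in>A (t *\<^sub>R x). e \<le> t * c"
          using sublinear_scale[OF sub(1), of _ t x] by (force simp: A_def)
      qed
      moreover have le: "Inf (A x) \<le> q x" if "q \<in> C" for q x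
        by (rule cInf_lower[OF _ bdd]) (use that in \<open>simp add: A_def\<close>)
      moreover have "Inf (A x) \<le> p x" for x
        using False le sub(2) order_trans by blast
      ultimately show ?thesis
        by (intro bexI[of _ "\<lambda>x. Inf (A x)"]) (auto simp: S_def le_fun_def)
    qed
  qed
  then obtain m where m: "m \<in> S" "\<And>q. q \<in> S \<Longrightarrow> q \<le> m \<Longrightarrow> q = m"
    by blast
  show ?thesis
  proof (rule that)
    show "sublinear m" "\<And>x. m x \<le> p x"
      using m(1) by (auto simp: S_def)
    show "q = m" if "sublinear q" "\<And>x. q x \<le> m x" for q
    proof (rule m(2))
      show "q \<in> S"
        using that m(1) by (auto simp: S_def intro: order_trans)
    qed (simp add: le_fun_def that(2))
  qed
qed

text \<open>A sublinear functional that is minimal is odd, because it agrees with its own minorant from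
  \<open>sublinear_minorant_at\<close> at every point; an odd sublinear functional is linear.\<close>

theorem Hahn_Banach_sublinear:
  assumes p: "sublinear p"
  obtains \<Phi> where "linear \<Phi>" "\<And>x. \<Phi> x \<le> p x" "\<Phi> v = p v"
proof -
  \<comment> \<open>Minimising below \<open>q\<close> instead of \<open>p\<close> secures the value
    at \<open>v\<close>: a linear \<open>m\<close> below \<open>q\<close> has
    \<open>m (- v) \<le> - p v\<close>, hence \<open>m v \<ge> p v\<close>.\<close>
  obtain q where q: "sublinear q" "\<And>x. q x \<le> p x" "q (- v) = - p v"
    using sublinear_minorant_at[OF p] by blast
  obtain m where m: "sublinear m" "\<And>x. m x \<le> q x"
      and minimal: "\<And>r. sublinear r \<Longrightarrow> (\<And>x. r x \<le> m x) \<Longrightarrow> r = m"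
    using minimal_sublinear[OF q(1)] by metis
  have odd: "m (- x) = - m x" for x
    using sublinear_minorant_at[OF m(1), of x] minimal by metis
  have "linear m"
  proof (rule linearI)
    show "m (x + y) = m x + m y" for x y
      using sublinear_add[OF m(1), of x y] sublinear_add[OF m(1), of "- x" "- y"]
        odd[of x] odd[of y] odd[of "x + y"] by simp
    show "m (c *\<^sub>R x) = c *\<^sub>R m x" for c x
      using sublinear_scale[OF m(1), of c x] sublinear_scale[OF m(1), of "- c" x] odd[of "c *\<^sub>R x"]
      by (cases "0 \<le> c") auto
  qed
  moreover have mp: "m x \<le> p x" for x
    using m(2) q(2) order_trans by blast
  moreover have "m v = p v"
    using m(2)[of "- v"] q(3) odd[of v] mp[of v] by simp
  ultimately show ?thesis
    by (rule that)
qed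

section \<open>Bounded functionals: separation from a subspace and generalised limits\<close>

lemma bounded_linear_le_norm:
  fixes \<Phi> :: "'a::real_normed_vector \<Rightarrow> real"
  assumes "linear \<Phi>" "\<And>x. \<Phi> x \<le> K * norm x"
  shows "bounded_linear \<Phi>"
proof (rule bounded_linear_intro[where K = K])
  fix x
  show "norm (\<Phi> x) \<le> norm x * K"
    using assms(2)[of x] assms(2)[of "- x"] linear_neg[OF assms(1), of x]
    by (simp add: abs_le_iff mult.commute)
qed (simp_all add: linear_add[OF assms(1)] linear_scale[OF assms(1)])

text \<open>Hahn-Banach for the distance to \<open>S\<close>, which is sublinear and at most the
  norm. It vanishes at \<open>s\<close> and \<open>- s\<close> for \<open>s \<in> S\<close>, which
  forces \<Phi> to vanish there.\<close>

lemma separate_subspace: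
  fixes S :: "'a::real_normed_vector set"
  assumes S: "subspace S"
  obtains \<Phi> :: "'a \<Rightarrow>\<^sub>L real" where "\<And>s. s \<in> S \<Longrightarrow> \<Phi> s = 0" "\<Phi> v = infdist v S"
proof -
  define A where "A x = (\<lambda>s. dist x s) ` S" for x
  have ne: "S \<noteq> {}"
    using subspace_0[OF S] by blast
  have infdist: "infdist x S = Inf (A x)" for x
    using ne by (simp add: infdist_def A_def)
  have "sublinear (\<lambda>x. Inf (A x))"
  proof (rule sublinear_Inf)
    show "A x \<noteq> {}" "bdd_below (A x)" for x
      using ne by (auto simp: A_def)
  next
    fix x y c d assume "c \<in> A x" "d \<in> A y"
    then obtain s t where "s \<in> S" "c = dist x s" "t \<in> S" "d = dist y t"
      by (auto simp: A_def)
    then show "\<exists>e\<in>A (x + y). e \<le> c + d"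
      unfolding A_def using subspace_add[OF S, of s t] dist_triangle_add[of x y s t] by blast
  next
    fix x c and t :: real assume "c \<in> A x" "0 < t"
    then obtain s where "s \<in> S" "c = dist x s"
      by (auto simp: A_def)
    then show "\<exists>e\<in>A (t *\<^sub>R x). e \<le> t * c"
      using \<open>0 < t\<close> subspace_scale[OF S, of s t]
      by (auto simp: A_def dist_norm simp flip: scaleR_diff_right intro!: bexI[of _ "t *\<^sub>R s"])
  qed
  then obtain \<Phi> where lin: "linear \<Phi>" and le: "\<And>x. \<Phi> x \<le> infdist x S" and v: "\<Phi> v = infdist v S"
    unfolding infdist[symmetric] using Hahn_Banach_sublinear by blast
  have "infdist x S \<le> 1 * norm x" for x
    using infdist_le[OF subspace_0[OF S], of x] by simp
  with le have bl: "bounded_linear \<Phi>"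
    by (intro bounded_linear_le_norm[OF lin]) (rule order_trans)
  have "\<Phi> s = 0" if "s \<in> S" for s
    using le[of s] le[of "- s"] that subspace_neg[OF S that] linear_neg[OF lin, of s] by simp
  with v show ?thesis
    by (intro that[of "Blinfun \<Phi>"]) (simp_all add: bounded_linear_Blinfun_apply[OF bl])
qed

text \<open>The functional plays the part of a weak-star cluster point of the \<open>w n\<close> in
  the bidual. \<open>Inf (A \<phi>)\<close> is the upper limit of the values of \<phi> along
  \<open>w\<close>; a linear functional below it lies between lower and upper limit, hence equals
  the limit where that exists.\<close>

lemma bidual_limit_functional:
  fixes w :: "nat \<Rightarrow> 'a::real_normed_vector"
  assumes w: "\<And>n. norm (w n) \<le> B"
  obtains \<mu> :: "('a \<Rightarrow>\<^sub>L real) \<Rightarrow>\<^sub>L real"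
    where "\<And>\<phi> L. (\<lambda>n. blinfun_apply \<phi> (w n)) \<longlonglongrightarrow> L \<Longrightarrow> \<mu> \<phi> = L"
proof -
  define A where "A \<phi> = {c. \<forall>\<^sub>F n in sequentially. blinfun_apply \<phi> (w n) \<le> c}" for \<phi> :: "'a \<Rightarrow>\<^sub>L real"
  have bound: "\<bar>blinfun_apply \<phi> (w n)\<bar> \<le> norm \<phi> * B" for \<phi> :: "'a \<Rightarrow>\<^sub>L real" and n
    using norm_blinfun[of \<phi> "w n"] mult_left_mono[OF w[of n], of "norm \<phi>"] by simp
  have lb: "- (norm \<phi> * B) \<le> c" if c: "c \<in> A \<phi>" for c \<phi>
  proof -
    obtain n where "blinfun_apply \<phi> (w n) \<le> c"
      using c by (auto simp: A_def eventually_sequentially)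
    with bound[of \<phi> n] show ?thesis by linarith
  qed
  have bdd: "bdd_below (A \<phi>)" for \<phi>
    using lb by (auto simp: bdd_below_def)
  have upper: "norm \<phi> * B \<in> A \<phi>" for \<phi>
    unfolding A_def using bound[of \<phi>] by (auto simp: abs_le_iff)
  have "sublinear (\<lambda>\<phi>. Inf (A \<phi>))"
  proof (rule sublinear_Inf[OF _ bdd])
    show "A \<phi> \<noteq> {}" for \<phi>
      using upper by blast
  next
    fix \<phi> \<psi> c d assume "c \<in> A \<phi>" "d \<in> A \<psi>"
    then have "c + d \<in> A (\<phi> + \<psi>)"
      unfolding A_def mem_Collect_eq
      by eventually_elim (simp add: blinfun.add_left)
    then show "\<exists>e\<in>A (\<phi> + \<psi>). e \<le> c + d" by blast
  next
    fix \<phi> c and t :: real assume "c \<in> A \<phi>" "0 < t"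
    then have "t * c \<in> A (t *\<^sub>R \<phi>)"
      unfolding A_def mem_Collect_eq
      by (auto elim!: eventually_mono simp: blinfun.scaleR_left)
    then show "\<exists>e\<in>A (t *\<^sub>R \<phi>). e \<le> t * c" by blast
  qed
  \<comment> \<open>The point of equality \<open>0\<close> is an arbitrary choice; the argument
    rests on domination by the upper limit.\<close>
  then obtain \<Phi> where lin: "linear \<Phi>" and le: "\<And>\<phi>. \<Phi> \<phi> \<le> Inf (A \<phi>)"
    using Hahn_Banach_sublinear[of _ 0] by metis
  have le': "\<Phi> \<phi> \<le> c" if "c \<in> A \<phi>" for c \<phi>
    using le cInf_lower[OF that bdd] by (rule order_trans)
  have bl: "bounded_linear \<Phi>"
    using le'[OF upper] by (intro bounded_linear_le_norm[OF lin]) (simp add: mult.commute)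
  have lim_le: "\<Phi> \<phi> \<le> L" if L: "(\<lambda>n. blinfun_apply \<phi> (w n)) \<longlonglongrightarrow> L" for \<phi> L
  proof (rule field_le_epsilon)
    fix e :: real assume "0 < e"
    then have "\<forall>\<^sub>F n in sequentially. blinfun_apply \<phi> (w n) < L + e"
      by (intro order_tendstoD[OF L]) simp
    then show "\<Phi> \<phi> \<le> L + e"
      by (intro le') (auto simp: A_def elim: eventually_mono)
  qed
  show ?thesis
  proof (rule that[of "Blinfun \<Phi>"])
    fix \<phi> :: "'a \<Rightarrow>\<^sub>L real" and L assume L: "(\<lambda>n. blinfun_apply \<phi> (w n)) \<longlonglongrightarrow> L"
    then have "(\<lambda>n. blinfun_apply (- \<phi>) (w n)) \<longlonglongrightarrow> - L"
      by (simp add: blinfun.minus_left tendsto_minus)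
    from lim_le[OF L] lim_le[OF this] show "Blinfun \<Phi> \<phi> = L"
      by (simp add: bounded_linear_Blinfun_apply[OF bl] linear_neg[OF lin])
  qed
qed

section \<open>Positive normalisation\<close>

text \<open>One factor \<open>D\<close> pays for moving the numerator, the other for moving the
  normaliser: the two totals differ by at most \<open>D\<close>, and both are at least 1, so
  division enlarges nothing.\<close>

lemma l1_normalised_diff:
  fixes a b :: "'g \<Rightarrow> real"
  assumes fin: "finite I" and A: "1 \<le> (\<Sum>h\<in>I. \<bar>a h\<bar>)" and B: "1 \<le> (\<Sum>h\<in>I. \<bar>b h\<bar>)"
  shows "(\<Sum>h\<in>I. \<bar>\<bar>a h\<bar> / (\<Sum>h\<in>I. \<bar>a h\<bar>) - \<bar>b h\<bar> / (\<Sum>h\<in>I. \<bar>b h\<bar>)\<bar>) \<le> 2 * (\<Sum>h\<in>I. \<bar>a h - b h\<bar>)"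
proof -
  define M where "M = (\<Sum>h\<in>I. \<bar>a h\<bar>)"
  define N where "N = (\<Sum>h\<in>I. \<bar>b h\<bar>)"
  define D where "D = (\<Sum>h\<in>I. \<bar>a h - b h\<bar>)"
  have MN: "1 \<le> M" "1 \<le> N"
    using A B by (simp_all add: M_def N_def)
  have "\<bar>N - M\<bar> = \<bar>\<Sum>h\<in>I. \<bar>b h\<bar> - \<bar>a h\<bar>\<bar>"
    by (simp add: M_def N_def sum_subtractf)
  also have "\<dots> \<le> (\<Sum>h\<in>I. \<bar>\<bar>b h\<bar> - \<bar>a h\<bar>\<bar>)"
    by (rule sum_abs)
  also have "\<dots> \<le> D"
    unfolding D_def by (rule sum_mono) linarith
  finally have NM: "\<bar>N - M\<bar> \<le> D" .
  have D0: "0 \<le> D"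
    by (simp add: D_def sum_nonneg)
  have "\<bar>\<bar>a h\<bar> / M - \<bar>b h\<bar> / N\<bar> \<le> \<bar>a h - b h\<bar> + \<bar>b h\<bar> * (D / N)" for h
  proof -
    have "\<bar>a h\<bar> / M - \<bar>b h\<bar> / N = (\<bar>a h\<bar> - \<bar>b h\<bar>) / M + \<bar>b h\<bar> * ((N - M) / (M * N))"
      using MN by (simp add: field_simps)
    also have "\<bar>\<dots>\<bar> \<le> \<bar>(\<bar>a h\<bar> - \<bar>b h\<bar>) / M\<bar> + \<bar>\<bar>b h\<bar> * ((N - M) / (M * N))\<bar>"
      by (rule abs_triangle_ineq)
    also have "\<dots> \<le> \<bar>a h - b h\<bar> + \<bar>b h\<bar> * (D / N)"
    proof (rule add_mono)
      have "\<bar>(\<bar>a h\<bar> - \<bar>b h\<bar>) / M\<bar> = \<bar>\<bar>a h\<bar> - \<bar>b h\<bar>\<bar> / M"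
        using MN by simp
      also have "\<dots> \<le> \<bar>a h - b h\<bar> / 1"
        using MN by (intro frac_le) auto
      finally show "\<bar>(\<bar>a h\<bar> - \<bar>b h\<bar>) / M\<bar> \<le> \<bar>a h - b h\<bar>" by simp
      have "1 * N \<le> M * N"
        using MN by (intro mult_right_mono) auto
      then have "\<bar>N - M\<bar> / (M * N) \<le> D / N"
        using MN NM by (intro frac_le) auto
      then have "\<bar>b h\<bar> * (\<bar>N - M\<bar> / (M * N)) \<le> \<bar>b h\<bar> * (D / N)"
        by (rule mult_left_mono) simp
      moreover have "\<bar>\<bar>b h\<bar> * ((N - M) / (M * N))\<bar> = \<bar>b h\<bar> * (\<bar>N - M\<bar> / (M * N))"
        using MN by (simp add: abs_mult)
      ultimately show "\<bar>\<bar>b h\<bar> * ((N - M) / (M * N))\<bar> \<le> \<bar>b h\<bar> * (D / N)"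
        by simp
    qed
    finally show ?thesis .
  qed
  then have "(\<Sum>h\<in>I. \<bar>\<bar>a h\<bar> / M - \<bar>b h\<bar> / N\<bar>) \<le> (\<Sum>h\<in>I. \<bar>a h - b h\<bar> + \<bar>b h\<bar> * (D / N))"
    by (intro sum_mono)
  also have "\<dots> = D + N * (D / N)"
    by (simp only: sum.distrib D_def N_def sum_distrib_right)
  also have "\<dots> = 2 * D"
    using MN by simp
  finally show ?thesis
    by (simp only: M_def N_def D_def)
qed

section \<open>Finitely supported elements of \<open>V\<close>\<close>

lemma infsum_eq_sum_support:
  fixes u :: "'g \<Rightarrow> 'b::{comm_monoid_add,t2_space}"
  assumes "finite I" "\<And>h. h \<notin> I \<Longrightarrow> u h = 0"
  shows "(\<Sum>\<^sub>\<infinity>h. u h) = (\<Sum>h\<in>I. u h)"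
proof -
  have "(\<Sum>\<^sub>\<infinity>h. u h) = infsum u I"
    by (rule infsum_cong_neutral) (use assms in auto)
  then show ?thesis using assms by simp
qed

text \<open>The finite sum of the sup norms of the values bounds all pointwise sums, so such a
  function belongs to \<open>V\<close>.\<close>

lemma coeff_Abs_V_finite:
  fixes f :: "'g \<Rightarrow> ('x::topological_space \<Rightarrow>\<^sub>C real)"
  assumes "finite {g. f g \<noteq> 0}"
  shows "coeff (Abs_V f) = f"
proof (rule Abs_V_inverse, rule CollectI, rule V_memI)
  have zero: "f g x = 0" if "g \<notin> {g. f g \<noteq> 0}" for g x
    using that by simp
  show "(\<lambda>g. \<bar>f g x\<bar>) summable_on UNIV" for x
  proof -
    have "(\<lambda>g. \<bar>f g x\<bar>) summable_on {g. f g \<noteq> 0}"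
      using assms by simp
    then show ?thesis
      by (rule summable_on_cong_neutral[THEN iffD1, rotated -1]) auto
  qed
  fix x
  have "(\<Sum>\<^sub>\<infinity>g. \<bar>f g x\<bar>) = (\<Sum>g | f g \<noteq> 0. \<bar>f g x\<bar>)"
    by (rule infsum_eq_sum_support[OF assms]) (simp add: zero)
  also have "\<dots> \<le> (\<Sum>g | f g \<noteq> 0. norm (f g))"
    using norm_bounded[of "f _" x] by (intro sum_mono) simp
  finally show "(\<Sum>\<^sub>\<infinity>g. \<bar>f g x\<bar>) \<le> (\<Sum>g | f g \<noteq> 0. norm (f g))" .
qed

text \<open>A point mass at an arbitrary index. It later serves as base point: every element of
  \<open>W00\<close> is a multiple of it plus an element of the kernel of
  \<open>pi00\<close>.\<close>

lemma exists_W00_pi00_one: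
  obtains d :: "('g, 'x::topological_space) V" where "d \<in> W00" "pi00 d = 1"
proof
  fix g0 :: 'g
  define f :: "'g \<Rightarrow> ('x \<Rightarrow>\<^sub>C real)" where "f h = (if h = g0 then const_bcontfun 1 else 0)" for h
  define d where "d = Abs_V f"
  have supp: "{g. f g \<noteq> 0} \<subseteq> {g0}"
    by (auto simp: f_def)
  have fin: "finite {g. f g \<noteq> 0}"
    by (rule finite_subset[OF supp]) simp
  have d: "coeff d = f"
    unfolding d_def by (rule coeff_Abs_V_finite[OF fin])
  have sum: "(\<Sum>\<^sub>\<infinity>g. coeff d g x) = 1" for x
    by (subst infsum_eq_sum_support[of "{g0}"]) (auto simp: d f_def)
  show "d \<in> W00"
    by (rule W00I[OF _ sum]) (simp add: d fin)
  then show "pi00 d = 1"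
    using pi00_infsum sum by metis
qed

lemma norm_W00_nonneg:
  assumes f: "f \<in> W00" and nonneg: "\<And>g x. coeff f g x \<ge> 0"
  shows "norm f \<le> pi00 f"
  by (rule V_norm_leI) (simp add: nonneg pi00_infsum[OF f, symmetric])

text \<open>Each coefficient is replaced by its absolute value divided by \<open>F\<close>, the
  pointwise sum of all the absolute values. \<open>F \<ge> 1\<close> keeps the quotients continuous
  and bounded, and the norm estimate reduces at each point to
  \<open>l1_normalised_diff\<close>.\<close>

lemma (in homeo_action) W00_normalise:
  assumes f: "f \<in> W00" and pi: "pi00 f = 1"
  obtains f' where "f' \<in> W00" "\<And>g x. coeff f' g x \<ge> 0" "pi00 f' = 1"
    "\<And>g. norm (f' - V_act \<alpha> g f') \<le> 2 * norm (f - V_act \<alpha> g f)"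
proof
  define I where "I = {h. coeff f h \<noteq> 0}"
  define F where "F x = (\<Sum>h\<in>I. \<bar>coeff f h x\<bar>)" for x
  define u where "u h = Bcontfun (\<lambda>x. \<bar>coeff f h x\<bar> / F x)" for h
  define f' where "f' = Abs_V u"
  have finI: "finite I"
    using f by (simp add: I_def W00_def)
  have zero: "coeff f h x = 0" if "h \<notin> I" for h x
    using that by (simp add: I_def)
  have F1: "1 \<le> F x" for x
  proof -
    have "1 = (\<Sum>h\<in>I. coeff f h x)"
      using pi00_infsum[OF f, of x] pi infsum_eq_sum_support[OF finI, of "\<lambda>h. coeff f h x"] zero
      by simp
    also have "\<dots> \<le> F x"
      unfolding F_def by (rule sum_mono) simp
    finally show ?thesis .
  qed
  have contF: "continuous_on UNIV F"
    unfolding F_def by (intro continuous_intros) simp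
  have u: "u h x = \<bar>coeff f h x\<bar> / F x" for h x
  proof -
    have "(\<lambda>x. \<bar>coeff f h x\<bar> / F x) \<in> bcontfun"
    proof (rule bcontfun_normI)
      show "continuous_on UNIV (\<lambda>x. \<bar>coeff f h x\<bar> / F x)"
      proof (intro continuous_intros contF)
        show "\<forall>x\<in>UNIV. F x \<noteq> 0"
          using F1 by (metis not_one_le_zero)
      qed simp
      fix x
      have "\<bar>coeff f h x\<bar> / F x \<le> \<bar>coeff f h x\<bar> / 1"
        using F1[of x] by (intro divide_left_mono) auto
      also have "\<dots> \<le> norm (coeff f h)"
        using norm_bounded[of "coeff f h" x] by simp
      finally show "norm (\<bar>coeff f h x\<bar> / F x) \<le> norm (coeff f h)"
        using F1[of x] by simp
    qed
    then show ?thesis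
      by (simp add: u_def Bcontfun_inverse)
  qed
  have u0: "u h = 0" if "h \<notin> I" for h
    by (rule bcontfun_eqI) (simp add: u zero[OF that])
  then have "{h. u h \<noteq> 0} \<subseteq> I" by blast
  then have fin: "finite {h. u h \<noteq> 0}"
    by (rule finite_subset[OF _ finI])
  have f': "coeff f' = u"
    unfolding f'_def by (rule coeff_Abs_V_finite[OF fin])
  have sum: "(\<Sum>\<^sub>\<infinity>h. coeff f' h x) = 1" for x
  proof -
    have "(\<Sum>\<^sub>\<infinity>h. coeff f' h x) = (\<Sum>h\<in>I. u h x)"
      unfolding f' by (rule infsum_eq_sum_support[OF finI]) (simp add: u0)
    also have "\<dots> = F x / F x"
      unfolding u sum_divide_distrib[symmetric] F_def[symmetric] ..
    finally show ?thesis
      using F1[of x] by simp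
  qed
  show "f' \<in> W00"
    by (rule W00I[OF _ sum]) (simp add: f' fin)
  then show "pi00 f' = 1"
    using pi00_infsum sum by metis
  show "coeff f' g x \<ge> 0" for g x
    using F1[of x] by (simp add: f' u)
  show "norm (f' - V_act \<alpha> g f') \<le> 2 * norm (f - V_act \<alpha> g f)" for g
  proof (rule V_norm_leI)
    fix x
    define a where "a h = coeff f h x" for h
    define b where "b h = coeff f (- g + h) (\<alpha> (- g) x)" for h
    \<comment> \<open>A common finite support: translation by \<open>g\<close> moves the support
      \<open>I\<close> of \<open>f\<close> to \<open>g + I\<close>, where \<open>b\<close>
      lives.\<close>
    define J where "J = I \<union> (\<lambda>h. g + h) ` I"
    have finJ: "finite J"
      using finI by (simp add: J_def)
    have a0: "a h = 0" if "h \<notin> J" for h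
      using that zero by (simp add: J_def a_def)
    have b0: "b h = 0" if "h \<notin> J" for h
    proof -
      have "- g + h \<notin> I"
        using that by (force simp: J_def image_iff add.assoc[symmetric])
      then show ?thesis
        by (simp add: b_def zero)
    qed
    have sum_infsum: "(\<Sum>\<^sub>\<infinity>h. w h) = (\<Sum>h\<in>J. w h)"
      if "\<And>h. a h = 0 \<Longrightarrow> b h = 0 \<Longrightarrow> w h = 0" for w :: "'g \<Rightarrow> real"
      by (rule infsum_eq_sum_support[OF finJ]) (simp add: that a0 b0)
    have F_infsum: "F y = (\<Sum>\<^sub>\<infinity>h. \<bar>coeff f h y\<bar>)" for y
      unfolding F_def by (rule infsum_eq_sum_support[OF finI, symmetric]) (simp add: zero)
    have Fa: "F x = (\<Sum>h\<in>J. \<bar>a h\<bar>)"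
      unfolding F_infsum a_def[symmetric] by (rule sum_infsum) simp
    \<comment> \<open>The translate of \<open>f'\<close> at \<open>x\<close> is normalised by
      \<open>F\<close> at the moved point; reindexing by \<open>- g + h\<close> shows this to be the
      total of \<open>b\<close>.\<close>
    have Fb: "F (\<alpha> (- g) x) = (\<Sum>h\<in>J. \<bar>b h\<bar>)"
      unfolding F_infsum shift_infsum[of f g, symmetric] b_def[symmetric] by (rule sum_infsum) simp
    have "(\<Sum>\<^sub>\<infinity>h. \<bar>coeff (f' - V_act \<alpha> g f') h x\<bar>)
        = (\<Sum>\<^sub>\<infinity>h. \<bar>\<bar>a h\<bar> / (\<Sum>h\<in>J. \<bar>a h\<bar>) - \<bar>b h\<bar> / (\<Sum>h\<in>J. \<bar>b h\<bar>)\<bar>)"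
      by (simp add: f' u a_def[symmetric] b_def[symmetric] Fa Fb)
    also have "\<dots> = (\<Sum>h\<in>J. \<bar>\<bar>a h\<bar> / (\<Sum>h\<in>J. \<bar>a h\<bar>) - \<bar>b h\<bar> / (\<Sum>h\<in>J. \<bar>b h\<bar>)\<bar>)"
      by (rule sum_infsum) simp
    also have "\<dots> \<le> 2 * (\<Sum>h\<in>J. \<bar>a h - b h\<bar>)"
      using F1[of x] F1[of "\<alpha> (- g) x"] unfolding Fa Fb by (rule l1_normalised_diff[OF finJ])
    also have "(\<Sum>h\<in>J. \<bar>a h - b h\<bar>) = (\<Sum>\<^sub>\<infinity>h. \<bar>a h - b h\<bar>)"
      by (rule sum_infsum[symmetric]) simp
    also have "\<dots> = (\<Sum>\<^sub>\<infinity>h. \<bar>coeff (f - V_act \<alpha> g f) h x\<bar>)"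
      by (simp add: a_def b_def)
    also have "\<dots> \<le> norm (f - V_act \<alpha> g f)"
      by (rule V_sum_le_norm)
    finally show "(\<Sum>\<^sub>\<infinity>h. \<bar>coeff (f' - V_act \<alpha> g f') h x\<bar>) \<le> 2 * norm (f - V_act \<alpha> g f)"
      by simp
  qed
qed

section \<open>Invariant means\<close>

lemma Abs_W0_inverse_W00: "f \<in> W00 \<Longrightarrow> Rep_W0 (Abs_W0 f) = f"
  using Abs_W0_inverse closure_subset by blast

lemma pi00_add:
  fixes f f' :: "('g, 'x::topological_space) V"
  assumes "f \<in> W00" "f' \<in> W00"
  shows "pi00 (f + f') = pi00 f + pi00 f'"
proof -
  \<comment> \<open>Types are inhabited, so there is a point at which to evaluate the constant
    sums.\<close>
  fix x :: 'x
  have s: "(\<Sum>\<^sub>\<infinity>g. coeff f g x) = pi00 f" "(\<Sum>\<^sub>\<infinity>g. coeff f' g x) = pi00 f'"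
    using pi00_infsum[OF assms(1), of x] pi00_infsum[OF assms(2), of x] by simp_all
  have "pi00 (f + f') = (\<Sum>\<^sub>\<infinity>g. coeff f g x + coeff f' g x)"
    using pi00_infsum[OF subspace_add[OF subspace_W00 assms], of x] by simp
  also have "\<dots> = pi00 f + pi00 f'"
    unfolding s[symmetric] by (rule infsum_add) simp_all
  finally show ?thesis .
qed

lemma pi00_scaleR:
  fixes f :: "('g, 'x::topological_space) V"
  assumes "f \<in> W00"
  shows "pi00 (c *\<^sub>R f) = c * pi00 f"
proof -
  fix x :: 'x
  have "pi00 (c *\<^sub>R f) = (\<Sum>\<^sub>\<infinity>g. c * coeff f g x)"
    using pi00_infsum[OF subspace_scale[OF subspace_W00 assms], of c x] by simp
  also have "\<dots> = c * (\<Sum>\<^sub>\<infinity>g. coeff f g x)"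
    by (rule infsum_cmult_right')
  also have "\<dots> = c * pi00 f"
    using pi00_infsum[OF assms, of x] by simp
  finally show ?thesis .
qed

lemma pi00_diff:
  assumes "f \<in> W00" "f' \<in> W00"
  shows "pi00 (f - f') = pi00 f - pi00 f'"
  using pi00_add[OF subspace_diff[OF subspace_W00 assms] assms(2)] by simp

lemma subspace_ker_pi00: "subspace {f \<in> (W00 :: ('a, 'b::topological_space) V set). pi00 f = 0}"
proof (rule subspaceI)
  have 0: "(0 :: ('a, 'b) V) \<in> W00"
    by (rule subspace_0[OF subspace_W00])
  show "(0 :: ('a, 'b) V) \<in> {f \<in> W00. pi00 f = 0}"
    using pi00_diff[OF 0 0] 0 by simp
qed (auto simp: pi00_add pi00_scaleR subspace_add[OF subspace_W00] subspace_scale[OF subspace_W00])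

section \<open>The two implications\<close>

context homeo_action
begin

text \<open>Positivity and total 1 make the sequence bounded, with \<open>piW\<close> equal to 1
  along it. A functional and its translate differ along it by a null sequence, so \<mu> takes the
  same value on both.\<close>

lemma invariant_mean_of_amenable:
  assumes "amenable_action \<alpha>"
  shows "\<exists>\<mu>. invariant_mean \<alpha> \<mu>"
proof -
  obtain f where f: "\<And>n::nat. f n \<in> W00" "\<And>n g x. coeff (f n) g x \<ge> 0" "\<And>n. pi00 (f n) = 1"
      and lim: "\<And>g. (\<lambda>n. norm (f n - V_act \<alpha> g (f n))) \<longlonglongrightarrow> 0"
    using assms unfolding amenable_action_def by metis
  define w where "w n = (Abs_W0 (f n) :: ('g, 'x) W0)" for n
  have Rep_w: "Rep_W0 (w n) = f n" for n
    by (simp add: w_def Abs_W0_inverse_W00 f)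
  have "norm (w n) \<le> 1" for n
    using norm_W00_nonneg[OF f(1,2)] f(3) by (simp add: norm_W0.rep_eq Rep_w)
  then obtain \<mu> :: "(('g, 'x) W0 \<Rightarrow>\<^sub>L real) \<Rightarrow>\<^sub>L real"
    where \<mu>: "\<And>\<phi> L. (\<lambda>n. blinfun_apply \<phi> (w n)) \<longlonglongrightarrow> L \<Longrightarrow> \<mu> \<phi> = L"
    using bidual_limit_functional by blast
  have "\<mu> piW = 1"
    by (rule \<mu>) (simp add: w_def piW_apply f)
  moreover have "\<mu> (dual_act \<alpha> g \<phi>) = \<mu> \<phi>" for g \<phi>
  proof -
    \<comment> \<open>The dual action of \<open>g\<close> moves vectors by the inverse, hence
      \<open>lim\<close> is used at \<open>- g\<close>.\<close>
    have "(\<lambda>n. norm (w n - W0_act \<alpha> (- g) (w n))) \<longlonglongrightarrow> 0"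
      using lim[of "- g"] by (simp add: norm_W0.rep_eq minus_W0.rep_eq Rep_w Rep_W0_act)
    then have "(\<lambda>n. \<phi> (w n - W0_act \<alpha> (- g) (w n))) \<longlonglongrightarrow> \<phi> 0"
      by (intro tendsto_intros) (rule tendsto_norm_zero_cancel)
    then have "(\<lambda>n. (\<phi> - dual_act \<alpha> g \<phi>) (w n)) \<longlonglongrightarrow> 0"
      by (simp add: blinfun.diff_left blinfun.diff_right dual_act_apply)
    from \<mu>[OF this] show ?thesis
      by (simp add: blinfun.diff_right)
  qed
  ultimately show ?thesis
    by (auto simp: invariant_mean_def is_mean_def)
qed

text \<open>Finitely many almost invariance conditions are one condition in a product of copies of \<open>V\<close>,
  realised inside the normed space \<open>nat \<Rightarrow>\<^sub>C V\<close> of bounded functions on the discrete space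
  \<open>nat\<close>; \<open>\<iota> n\<close> is the inclusion of the \<open>n\<close>-th factor.\<close>

lemma almost_invariant_of_invariant_mean:
  fixes s :: "nat \<Rightarrow> 'g" and m :: nat
  assumes \<mu>: "invariant_mean \<alpha> \<mu>" and \<epsilon>: "0 < \<epsilon>"
  obtains f where "f \<in> W00" "pi00 f = 1" "\<And>n. n < m \<Longrightarrow> norm (f - V_act \<alpha> (s n) f) < \<epsilon>"
proof -
  define D where "D n f = f - V_act \<alpha> (s n) f" for n and f :: "('g, 'x) V"
  have D_linear: "linear (D n)" for n
    unfolding D_def by (intro linear_compose_sub linear_ident V_act_linear)
  define \<iota> where "\<iota> n v = Bcontfun (\<lambda>k::nat. if k = n then v else 0)" for n and v :: "('g, 'x) V"
  have \<iota>: "\<iota> n v k = (if k = n then v else 0)" for n v k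
  proof -
    have "(\<lambda>k::nat. if k = n then v else 0) \<in> bcontfun"
      by (rule bcontfun_normI[where b = "norm v"]) auto
    then show ?thesis
      by (simp add: \<iota>_def Bcontfun_inverse)
  qed
  have \<iota>_linear: "linear (\<iota> n)" for n
    by (rule linearI; rule bcontfun_eqI) (auto simp: \<iota>)
  have \<iota>_norm: "norm (\<iota> n v) \<le> norm v" for n v
    by (rule norm_bound) (simp add: \<iota>)
  define T where "T f = (\<Sum>n<m. \<iota> n (D n f))" for f
  have T_linear: "linear T"
    unfolding T_def
    by (intro linear_compose_sum ballI linear_compose[OF D_linear \<iota>_linear, unfolded o_def])
  have T: "T f n = D n f" if "n < m" for f n
  proof -
    have "apply_bcontfun (\<Sum>k\<in>K. \<iota> k (D k f)) n = (\<Sum>k\<in>K. \<iota> k (D k f) n)" if "finite K" for K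
      using that by (induction K) simp_all
    then show ?thesis
      using that by (simp add: T_def \<iota>)
  qed
  obtain d :: "('g, 'x) V" where d: "d \<in> W00" "pi00 d = 1"
    by (rule exists_W00_pi00_one)
  \<comment> \<open>The elements of \<open>W00\<close> with \<open>pi00\<close> equal to 1 are the
    \<open>d - k\<close> with \<open>k \<in> K\<close>, so the goal is that \<open>T d\<close> lies
    in the closure of the image of \<open>K\<close> under \<open>T\<close>.\<close>
  define K where "K = {f \<in> (W00 :: ('g, 'x) V set). pi00 f = 0}"
  have "subspace (T ` K)"
    unfolding K_def by (rule linear_subspace_image[OF T_linear subspace_ker_pi00])
  then obtain \<Phi> :: "(nat \<Rightarrow>\<^sub>C ('g, 'x) V) \<Rightarrow>\<^sub>L real"
    where \<Phi>0: "\<And>k. k \<in> T ` K \<Longrightarrow> \<Phi> k = 0" and \<Phi>d: "\<Phi> (T d) = infdist (T d) (T ` K)"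
    using separate_subspace[of "T ` K" "T d"] by blast
  \<comment> \<open>The restriction of \<Phi> to the \<open>n\<close>-th factor, pulled back to
    \<open>W0\<close>.\<close>
  define \<phi> where "\<phi> n = Blinfun (\<lambda>w. \<Phi> (\<iota> n (Rep_W0 w)))" for n
  have \<phi>: "\<phi> n w = \<Phi> (\<iota> n (Rep_W0 w))" for n w
  proof -
    have "bounded_linear (\<lambda>w. \<iota> n (Rep_W0 w))"
      by (rule bounded_linear_intro[where K = 1])
         (simp_all add: plus_W0.rep_eq scaleR_W0.rep_eq norm_W0.rep_eq \<iota>_norm
           linear_add[OF \<iota>_linear] linear_scale[OF \<iota>_linear])
    from bounded_linear_compose[OF blinfun.bounded_linear_right[of \<Phi>] this] show ?thesis
      by (simp add: \<phi>_def bounded_linear_Blinfun_apply)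
  qed
  \<comment> \<open>The pullback of \<Phi> along \<open>T\<close>, written as differences that \<mu>
    kills; the sign in \<open>- s n\<close> cancels the inverse in the dual action.\<close>
  define \<psi> where "\<psi> = (\<Sum>n<m. \<phi> n - dual_act \<alpha> (- s n) (\<phi> n))"
  have \<psi>: "\<psi> (Abs_W0 f) = \<Phi> (T f)" if f: "f \<in> W00" for f
    by (simp add: \<psi>_def T_def D_def \<phi> blinfun.sum_left blinfun.sum_right blinfun.diff_left
        blinfun.diff_right dual_act_apply Rep_W0_act Abs_W0_inverse_W00[OF f] linear_diff[OF \<iota>_linear])
  \<comment> \<open>Subtracting \<open>pi00 f *\<^sub>R d\<close> from \<open>f\<close> lands in
    \<open>K\<close>, where \<Phi> after \<open>T\<close> vanishes. Applying \<mu> to this identity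
    then yields \<open>\<Phi> (T d) = 0\<close>, which is the distance in question.\<close>
  have "\<psi> = \<Phi> (T d) *\<^sub>R piW"
  proof (rule W0_functional_unique)
    fix f :: "('g, 'x) V" assume f: "f \<in> W00"
    have fd: "pi00 f *\<^sub>R d \<in> W00"
      by (rule subspace_scale[OF subspace_W00 d(1)])
    have "f - pi00 f *\<^sub>R d \<in> K"
      using subspace_diff[OF subspace_W00 f fd] pi00_diff[OF f fd] pi00_scaleR[OF d(1)] d(2)
      by (simp add: K_def)
    then have "\<Phi> (T (f - pi00 f *\<^sub>R d)) = 0"
      by (intro \<Phi>0 imageI)
    then show "\<psi> (Abs_W0 f) = (\<Phi> (T d) *\<^sub>R piW) (Abs_W0 f)"
      by (simp add: \<psi>[OF f] piW_apply[OF f] blinfun.scaleR_left linear_diff[OF T_linear]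
          linear_scale[OF T_linear] blinfun.diff_right blinfun.scaleR_right)
  qed
  moreover have "\<mu> \<psi> = 0"
    using \<mu> by (simp add: \<psi>_def blinfun.sum_right blinfun.diff_right invariant_mean_def)
  ultimately have "infdist (T d) (T ` K) = 0"
    using \<mu> \<Phi>d by (simp add: blinfun.scaleR_right invariant_mean_def is_mean_def)
  \<comment> \<open>Zero distance implies membership in the closure for a nonempty set only, as
    \<open>infdist\<close> to the empty set is 0 by convention.\<close>
  moreover have "0 \<in> K"
    unfolding K_def by (rule subspace_0[OF subspace_ker_pi00])
  ultimately have "T d \<in> closure (T ` K)"
    by (subst in_closure_iff_infdist_zero) auto
  with \<epsilon> obtain k where k: "k \<in> K" "dist (T d) (T k) < \<epsilon>"
    by (auto simp: closure_approachable dist_commute)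
  show ?thesis
  proof (rule that)
    show "d - k \<in> W00" "pi00 (d - k) = 1"
      using k(1) d by (auto simp: K_def pi00_diff subspace_diff[OF subspace_W00])
    fix n assume n: "n < m"
    have "norm (T (d - k) n) < \<epsilon>"
      using norm_bounded[of "T (d - k)" n] k(2) by (simp add: dist_norm linear_diff[OF T_linear])
    then show "norm (d - k - V_act \<alpha> (s n) (d - k)) < \<epsilon>"
      using T[OF n] by (simp add: D_def)
  qed
qed

end

text \<open>A diagonal choice along an enumeration of the countable group: the \<open>n\<close>-th
  function is almost invariant under the first \<open>n\<close> elements, with a tolerance tending
  to 0. The factor 2 comes from \<open>W00_normalise\<close>.\<close>

lemma amenable_of_invariant_mean:
  fixes \<alpha> :: "'g::{group_add, countable} \<Rightarrow> 'x::topological_space \<Rightarrow> 'x"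
  assumes \<alpha>: "homeo_action \<alpha>" and \<mu>: "invariant_mean \<alpha> \<mu>"
  shows "amenable_action \<alpha>"
proof -
  interpret homeo_action \<alpha> by (rule \<alpha>)
  have "\<exists>f. f \<in> W00 \<and> (\<forall>g x. coeff f g x \<ge> 0) \<and> pi00 f = 1 \<and>
      (\<forall>k<n. norm (f - V_act \<alpha> (from_nat k) f) < 2 * inverse (real (Suc n)))" for n
  proof -
    obtain f where f: "f \<in> W00" "pi00 f = 1"
        and small: "\<And>k. k < n \<Longrightarrow> norm (f - V_act \<alpha> (from_nat k) f) < inverse (real (Suc n))"
      using almost_invariant_of_invariant_mean[OF \<mu>, of "inverse (real (Suc n))" n from_nat]
      by auto
    from W00_normalise[OF f] obtain f' where f': "f' \<in> W00" "\<And>g x. coeff f' g x \<ge> 0" "pi00 f' = 1"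
        and le: "\<And>g. norm (f' - V_act \<alpha> g f') \<le> 2 * norm (f - V_act \<alpha> g f)"
      by blast
    have "norm (f' - V_act \<alpha> (from_nat k) f') < 2 * inverse (real (Suc n))" if "k < n" for k
      using le[of "from_nat k"] small[OF that] by linarith
    with f' show ?thesis by blast
  qed
  then obtain f where f: "\<And>n. f n \<in> W00" "\<And>n g x. coeff (f n) g x \<ge> 0" "\<And>n. pi00 (f n) = 1"
    and small: "\<And>n k. k < n \<Longrightarrow>
      norm (f n - V_act \<alpha> (from_nat k) (f n)) < 2 * inverse (real (Suc n))"
    by metis
  have "(\<lambda>n. norm (f n - V_act \<alpha> g (f n))) \<longlonglongrightarrow> 0" for g
  proof (rule real_tendsto_sandwich[where f = "\<lambda>_. 0" and h = "\<lambda>n. 2 * inverse (real (Suc n))"])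
    \<comment> \<open>The element \<open>g\<close> has index \<open>to_nat g\<close> and is covered
      once \<open>n\<close> exceeds it, hence the start at \<open>Suc (to_nat g)\<close>.\<close>
    show "\<forall>\<^sub>F n in sequentially. norm (f n - V_act \<alpha> g (f n)) \<le> 2 * inverse (real (Suc n))"
      using small[of "to_nat g"]
      by (intro eventually_sequentiallyI[of "Suc (to_nat g)"]) (simp add: less_imp_le del: of_nat_Suc)
    show "(\<lambda>n. 2 * inverse (real (Suc n))) \<longlonglongrightarrow> 0"
      using tendsto_mult_right_zero[OF LIMSEQ_inverse_real_of_nat] .
  qed simp_all
  with f show ?thesis
    unfolding amenable_action_def by blast
qed

theorem theoremA:
  fixes \<alpha> :: "'g::{group_add, countable} \<Rightarrow> 'x::t2_space \<Rightarrow> 'x"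
  assumes "compact (UNIV :: 'x set)"
    and "homeo_action \<alpha>"
  shows "amenable_action \<alpha> \<longleftrightarrow>
    (\<exists>\<mu> :: (('g, 'x) W0 \<Rightarrow>\<^sub>L real) \<Rightarrow>\<^sub>L real. invariant_mean \<alpha> \<mu>)"
  using homeo_action.invariant_mean_of_amenable[OF assms(2)] amenable_of_invariant_mean[OF assms(2)]
  by blast

end
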